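(* An immersion $x:M^m\to\mathbb{R}^{m+p}$ is a $\xi$-submanifold if and only if its modified mean curvature $\tilde H$ is parallel, that is, $\bar D^\perp\tilde H\equiv 0$.
   Context: Let $x:M^m\to\mathbb{R}^{m+p}$ be a smooth immersion of an $m$-dimensional manifold, with Euclidean metric $\langle\cdot,\cdot\rangle$, flat connection $D$, induced metric $g$, second fundamental form $h(X,Y)=(D_XY)^\perp$, mean curvature vector $H=\mathrm{tr}_g h$ (unnormalized) and normal connection $D^\perp$. $x^\perp$ denotes the normal component of the position vector. $x$ is a $\xi$-submanifold if the normal field $H+x^\perp$ is parallel, i.e. there is a normal field $\xi$ with $D^\perp\xi=0$ and $H+x^\perp=\xi$. The Gaussian space is $\mathbb{R}^{m+p}$ with the conformal metric $\bar g=e^{-|x|^2/m}\langle\cdot,\cdot\rangle$. Viewing $x$ as an immersion into $(\mathbb{R}^{m+p},\bar g)$, let $\bar H$ be its mean curvature vector (trace, with respect to the metric induced by $\bar g$, of its second fundamental form), and $\bar D^\perp$ its normal connection, induced by the Levi-Civita connection of $\bar g$ (the normal bundle is the same because $\bar g$ is conformal to $\langle\cdot,\cdot\rangle$). The modified mean curvature is $\tilde H=e^{-|x|^2/(2m)}\bar H$. *)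

theory Defs
  imports "HOL-Analysis.Analysis"
begin

section \<open>Smooth maps and smooth manifolds\<close>

text \<open>
  Both notions are used on open sets only: \<open>Ck_on k S f\<close> says that \<open>f\<close> is \<open>k\<close> times continuously
  differentiable on the open set \<open>S\<close>, via iterated directional derivatives.
\<close>

primrec Ck_on :: "nat \<Rightarrow> 'a::euclidean_space set \<Rightarrow> ('a \<Rightarrow> 'b::euclidean_space) \<Rightarrow> bool" where
  "Ck_on 0 S f \<longleftrightarrow> continuous_on S f"
| "Ck_on (Suc k) S f \<longleftrightarrow>
     (\<forall>x\<in>S. f differentiable (at x)) \<and>
     (\<forall>v. Ck_on k S (\<lambda>x. frechet_derivative f (at x) v))"

definition smooth_on :: "'a::euclidean_space set \<Rightarrow> ('a \<Rightarrow> 'b::euclidean_space) \<Rightarrow> bool" where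
  "smooth_on S f \<longleftrightarrow> (\<forall>k. Ck_on k S f)"

type_synonym ('a, 'm) chart = "'a set \<times> ('a \<Rightarrow> real ^ 'm)"

definition is_chart :: "'a topology \<Rightarrow> ('a, 'm::finite) chart \<Rightarrow> bool" where
  "is_chart M c \<longleftrightarrow>
     (case c of (U, \<phi>) \<Rightarrow>
        openin M U \<and> open (\<phi> ` U) \<and>
        homeomorphic_map (subtopology M U) (top_of_set (\<phi> ` U)) \<phi>)"

definition smooth_manifold :: "'a topology \<Rightarrow> ('a, 'm::finite) chart set \<Rightarrow> bool" where
  "smooth_manifold M A \<longleftrightarrow>
     Hausdorff_space M \<and> second_countable M \<and>
     (\<forall>c\<in>A. is_chart M c) \<and>
     topspace M = (\<Union>c\<in>A. fst c) \<and>
     (\<forall>(U, \<phi>)\<in>A. \<forall>(V, \<psi>)\<in>A. smooth_on (\<phi> ` (U \<inter> V)) (\<psi> \<circ> inv_into U \<phi>))"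

definition smooth_map :: "('a, 'm::finite) chart set \<Rightarrow> ('a \<Rightarrow> 'b::euclidean_space) \<Rightarrow> bool" where
  "smooth_map A f \<longleftrightarrow> (\<forall>(U, \<phi>)\<in>A. smooth_on (\<phi> ` U) (f \<circ> inv_into U \<phi>))"

text \<open>
  Tangent vectors at \<open>q\<close> are given by their components \<open>v\<close> in a chart \<open>c\<close> around \<open>q\<close>;
  \<open>deriv_in c f q v\<close> is the derivative \<open>df\<^sub>q(v)\<close> of a vector-valued function \<open>f\<close> on the manifold.
\<close>

definition deriv_in ::
    "('a, 'm::finite) chart \<Rightarrow> ('a \<Rightarrow> 'b::euclidean_space) \<Rightarrow> 'a \<Rightarrow> real ^ 'm \<Rightarrow> 'b" where
  "deriv_in c f q v =
     (case c of (U, \<phi>) \<Rightarrow> frechet_derivative (f \<circ> inv_into U \<phi>) (at (\<phi> q)) v)"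

definition smooth_immersion :: "('a, 'm::finite) chart set \<Rightarrow> ('a \<Rightarrow> 'b::euclidean_space) \<Rightarrow> bool" where
  "smooth_immersion A x \<longleftrightarrow>
     smooth_map A x \<and> (\<forall>c\<in>A. \<forall>q\<in>fst c. inj (deriv_in c x q))"

text \<open>
  A chart around \<open>q\<close>. It is used to write down pointwise geometric quantities
  (tangent space, mean curvature) whose value does not depend on the chart.
\<close>

definition chart_at :: "('a, 'm::finite) chart set \<Rightarrow> 'a \<Rightarrow> ('a, 'm) chart" where
  "chart_at A q = (SOME c. c \<in> A \<and> q \<in> fst c)"


section \<open>Riemannian metrics on the ambient vector space\<close>

text \<open>A metric \<open>G\<close> on the ambient space; \<open>G y\<close> is the inner product on the tangent space at \<open>y\<close>.\<close>

type_synonym 'b ambient_metric = "'b \<Rightarrow> 'b \<Rightarrow> 'b \<Rightarrow> real"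

definition euclidean_metric :: "'b::euclidean_space ambient_metric" where
  "euclidean_metric = (\<lambda>y v w. v \<bullet> w)"

definition gaussian_metric :: "nat \<Rightarrow> 'b::euclidean_space ambient_metric" where
  "gaussian_metric m = (\<lambda>y v w. exp (- (norm y)\<^sup>2 / real m) * (v \<bullet> w))"

text \<open>
  The Levi-Civita connection of \<open>G\<close> is \<open>\<nabla>\<^sub>V W = D\<^sub>V W + \<Gamma>(V, W)\<close>, where the Christoffel form \<open>\<Gamma>\<close> is
  determined by torsion-freeness (\<open>\<Gamma>\<close> symmetric) and metric compatibility
  \<open>V(G(W, Z)) = G(\<nabla>\<^sub>V W, Z) + G(W, \<nabla>\<^sub>V Z)\<close>, both tested on constant vector fields.
\<close>

definition christoffel :: "'b::euclidean_space ambient_metric \<Rightarrow> 'b \<Rightarrow> 'b \<Rightarrow> 'b \<Rightarrow> 'b" where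
  "christoffel G y =
     (THE \<Gamma>. bilinear \<Gamma> \<and>
        (\<forall>v w. \<Gamma> v w = \<Gamma> w v) \<and>
        (\<forall>v w z. frechet_derivative (\<lambda>y'. G y' w z) (at y) v = G y (\<Gamma> v w) z + G y w (\<Gamma> v z)))"

text \<open>The \<open>G\<close>-orthogonal projection at \<open>y\<close> onto the normal space of a subspace \<open>T\<close>.\<close>

definition normal_part :: "'b::euclidean_space ambient_metric \<Rightarrow> 'b \<Rightarrow> 'b set \<Rightarrow> 'b \<Rightarrow> 'b" where
  "normal_part G y T z = (THE n. (\<forall>t\<in>T. G y n t = 0) \<and> z - n \<in> T)"


section \<open>Geometry of an immersion into the ambient space with metric \<open>G\<close>\<close>

text \<open>
  \<open>pullback_conn G c x N q v\<close> is \<open>\<nabla>\<^sub>v N\<close> at \<open>q\<close> for a vector field \<open>N\<close> along \<open>x\<close>, with \<open>\<nabla>\<close> the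
  Levi-Civita connection of \<open>G\<close>.
\<close>

definition pullback_conn :: "'b::euclidean_space ambient_metric \<Rightarrow> ('a, 'm::finite) chart \<Rightarrow>
    ('a \<Rightarrow> 'b) \<Rightarrow> ('a \<Rightarrow> 'b) \<Rightarrow> 'a \<Rightarrow> real ^ 'm \<Rightarrow> 'b" where
  "pullback_conn G c x N q v =
     deriv_in c N q v + christoffel G (x q) (deriv_in c x q v) (N q)"

definition tangent_image ::
    "('a, 'm::finite) chart \<Rightarrow> ('a \<Rightarrow> 'b::euclidean_space) \<Rightarrow> 'a \<Rightarrow> 'b set" where
  "tangent_image c x q = range (deriv_in c x q)"

definition normal_conn :: "'b::euclidean_space ambient_metric \<Rightarrow> ('a, 'm::finite) chart \<Rightarrow>
    ('a \<Rightarrow> 'b) \<Rightarrow> ('a \<Rightarrow> 'b) \<Rightarrow> 'a \<Rightarrow> real ^ 'm \<Rightarrow> 'b" where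
  "normal_conn G c x N q v =
     normal_part G (x q) (tangent_image c x q) (pullback_conn G c x N q v)"

text \<open>
  \<open>h(v, w) = (\<nabla>\<^sub>v dx(W))\<^sup>\<bottom>\<close>, where the tangent vector \<open>w\<close> is extended to the vector field \<open>W\<close> with
  constant components in the chart \<open>c\<close>.
\<close>

definition second_ff :: "'b::euclidean_space ambient_metric \<Rightarrow> ('a, 'm::finite) chart \<Rightarrow>
    ('a \<Rightarrow> 'b) \<Rightarrow> 'a \<Rightarrow> real ^ 'm \<Rightarrow> real ^ 'm \<Rightarrow> 'b" where
  "second_ff G c x q v w =
     normal_part G (x q) (tangent_image c x q)
       (pullback_conn G c x (\<lambda>q'. deriv_in c x q' w) q v)"

text \<open>The matrix \<open>(g\<^sub>i\<^sub>j)\<close> of the metric induced on the manifold.\<close>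

definition induced_metric :: "'b::euclidean_space ambient_metric \<Rightarrow> ('a, 'm::finite) chart \<Rightarrow>
    ('a \<Rightarrow> 'b) \<Rightarrow> 'a \<Rightarrow> real ^ 'm ^ 'm" where
  "induced_metric G c x q =
     (\<chi> i j. G (x q) (deriv_in c x q (axis i 1)) (deriv_in c x q (axis j 1)))"

text \<open>The (unnormalized) trace \<open>g\<^sup>i\<^sup>j h\<^sub>i\<^sub>j\<close>.\<close>

definition mean_curvature :: "'b::euclidean_space ambient_metric \<Rightarrow> ('a, 'm::finite) chart set \<Rightarrow>
    ('a \<Rightarrow> 'b) \<Rightarrow> 'a \<Rightarrow> 'b" where
  "mean_curvature G A x q =
     (let c = chart_at A q in
      \<Sum>i\<in>UNIV. \<Sum>j\<in>UNIV.
        matrix_inv (induced_metric G c x q) $ i $ j *\<^sub>R second_ff G c x q (axis i 1) (axis j 1))"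

definition normal_field :: "'b::euclidean_space ambient_metric \<Rightarrow> ('a, 'm::finite) chart set \<Rightarrow>
    ('a \<Rightarrow> 'b) \<Rightarrow> ('a \<Rightarrow> 'b) \<Rightarrow> bool" where
  "normal_field G A x N \<longleftrightarrow>
     smooth_map A N \<and> (\<forall>c\<in>A. \<forall>q\<in>fst c. \<forall>t\<in>tangent_image c x q. G (x q) (N q) t = 0)"

definition parallel_normal_field :: "'b::euclidean_space ambient_metric \<Rightarrow> ('a, 'm::finite) chart set \<Rightarrow>
    ('a \<Rightarrow> 'b) \<Rightarrow> ('a \<Rightarrow> 'b) \<Rightarrow> bool" where
  "parallel_normal_field G A x N \<longleftrightarrow>
     normal_field G A x N \<and> (\<forall>c\<in>A. \<forall>q\<in>fst c. \<forall>v. normal_conn G c x N q v = 0)"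


section \<open>Submanifolds with parallel \<open>H + x\<^sup>\<bottom>\<close>, and the modified mean curvature\<close>

definition position_normal ::
    "('a, 'm::finite) chart set \<Rightarrow> ('a \<Rightarrow> 'b::euclidean_space) \<Rightarrow> 'a \<Rightarrow> 'b" where
  "position_normal A x q =
     normal_part euclidean_metric (x q) (tangent_image (chart_at A q) x q) (x q)"

definition xi_submanifold ::
    "'a topology \<Rightarrow> ('a, 'm::finite) chart set \<Rightarrow> ('a \<Rightarrow> 'b::euclidean_space) \<Rightarrow> bool" where
  "xi_submanifold M A x \<longleftrightarrow>
     (\<exists>\<xi>. parallel_normal_field euclidean_metric A x \<xi> \<and>
          (\<forall>q\<in>topspace M. mean_curvature euclidean_metric A x q + position_normal A x q = \<xi> q))"

definition modified_mean_curvature ::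
    "('a, 'm::finite) chart set \<Rightarrow> ('a \<Rightarrow> 'b::euclidean_space) \<Rightarrow> 'a \<Rightarrow> 'b" where
  "modified_mean_curvature A x q =
     exp (- (norm (x q))\<^sup>2 / (2 * real CARD('m))) *\<^sub>R
       mean_curvature (gaussian_metric CARD('m)) A x q"

text \<open>
  For the Euclidean metric the Levi-Civita connection is the flat connection \<open>D\<close>, so all notions
  above specialise to the usual ones.
\<close>

lemma christoffel_euclidean: "christoffel euclidean_metric y v w = (0 :: 'b::euclidean_space)"
proof -
  have "christoffel euclidean_metric y = (\<lambda>_ _. 0 :: 'b)"
    unfolding christoffel_def euclidean_metric_def
  proof (rule the_equality)
    show "bilinear (\<lambda>_ _. 0 :: 'b) \<and> (\<forall>(v::'b) (w::'b). (0::'b) = 0) \<and>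
      (\<forall>v (w::'b) z. frechet_derivative (\<lambda>y'. w \<bullet> z) (at y) v = 0 \<bullet> z + w \<bullet> 0)"
      by (simp add: bilinear_def linear_iff frechet_derivative_const)
  next
    fix \<Gamma> :: "'b \<Rightarrow> 'b \<Rightarrow> 'b"
    assume "bilinear \<Gamma> \<and> (\<forall>v w. \<Gamma> v w = \<Gamma> w v) \<and>
      (\<forall>v w z. frechet_derivative (\<lambda>y'. w \<bullet> z) (at y) v = \<Gamma> v w \<bullet> z + w \<bullet> \<Gamma> v z)"
    then have sym: "\<And>a b. \<Gamma> a b = \<Gamma> b a"
      and compat: "\<And>a b c. frechet_derivative (\<lambda>y'. b \<bullet> c) (at y) a = \<Gamma> a b \<bullet> c + b \<bullet> \<Gamma> a c"
      by blast+
    have skew: "\<Gamma> a b \<bullet> c = - (\<Gamma> a c \<bullet> b)" for a b c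
      using compat[of b c a] by (simp add: frechet_derivative_const inner_commute)
    have zero: "\<Gamma> a b \<bullet> c = 0" for a b c
    proof -
      have "\<Gamma> a b \<bullet> c = - (\<Gamma> c a \<bullet> b)" by (simp only: skew[of a b c] sym[of a c])
      also have "\<dots> = \<Gamma> b c \<bullet> a" by (simp only: skew[of c a b] sym[of c b] minus_minus)
      also have "\<dots> = - (\<Gamma> a b \<bullet> c)" by (simp only: skew[of b c a] sym[of b a])
      finally show ?thesis by simp
    qed
    show "\<Gamma> = (\<lambda>_ _. 0)"
    proof (intro ext)
      show "\<Gamma> a b = 0" for a b using zero[of a b "\<Gamma> a b"] by simp
    qed
  qed
  then show ?thesis by simp
qed

end

theory Submission
  imports Defs
begin

text \<open>
  Write the Gaussian metric as \<open>exp (2f) \<langle>\<cdot>,\<cdot>\<rangle>\<close> with \<open>f = -|y|\<^sup>2/(2m)\<close>. The conformal change of the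
  connection adds \<open>\<langle>v,w\<rangle> x\<^sup>\<bottom>/m\<close> to the second fundamental form, and tracing with the rescaled inverse
  metric gives the Gaussian mean curvature \<open>exp (|x|\<^sup>2/m) (H + x\<^sup>\<bottom>)\<close>; hence the modified mean curvature is
  \<open>exp (|x|\<^sup>2/(2m)) (H + x\<^sup>\<bottom>)\<close>. On normal fields the conformal normal connection is
  \<open>D\<^sup>\<bottom> - d(|x|\<^sup>2)/(2m)\<close>, so multiplication by \<open>exp (|x|\<^sup>2/(2m))\<close> intertwines the two normal
  connections. Smoothness of the mean curvature is not an issue: either side of the equivalence
  contains it for \<open>H + x\<^sup>\<bottom>\<close> up to a smooth positive factor.
\<close>

section \<open>Calculus of \<open>C\<^sup>k\<close> maps\<close>

lemma frechet_derivative_eqI: "(f has_derivative f') (at x) \<Longrightarrow> frechet_derivative f (at x) = f'"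
  by (rule frechet_derivative_at[symmetric])

text \<open>Derivatives at a point see only nearby values, so on an open set agreement passes to all
  iterated derivatives.\<close>

lemma Ck_on_cong:
  assumes "open S" "\<And>x. x \<in> S \<Longrightarrow> f x = g x" "Ck_on k S f"
  shows "Ck_on k S g"
  using assms(2,3)
proof (induction k arbitrary: f g)
  case 0
  then show ?case by (simp cong: continuous_on_cong)
next
  case (Suc k)
  have der: "(g has_derivative frechet_derivative f (at x)) (at x)" if "x \<in> S" for x
  proof (rule has_derivative_transform_within_open[OF _ assms(1) that])
    show "(f has_derivative frechet_derivative f (at x)) (at x)"
      using Suc.prems(2) that by (simp add: frechet_derivative_works)
  qed (use Suc.prems(1) in auto)
  have "Ck_on k S (\<lambda>x. frechet_derivative g (at x) v)" for v
  proof (rule Suc.IH)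
    show "frechet_derivative f (at x) v = frechet_derivative g (at x) v" if "x \<in> S" for x
      using frechet_derivative_eqI[OF der[OF that]] by simp
    show "Ck_on k S (\<lambda>x. frechet_derivative f (at x) v)"
      using Suc.prems(2) by simp
  qed
  then show ?case
    using der by (auto simp: differentiable_def)
qed

text \<open>Lets an explicit derivative formula stand in for the choice term
  \<open>frechet_derivative\<close>, so that the closure properties below follow from the usual
  differentiation rules.\<close>

lemma Ck_on_SucI:
  assumes "open S" "\<And>x. x \<in> S \<Longrightarrow> (f has_derivative f' x) (at x)" "\<And>v. Ck_on k S (\<lambda>x. f' x v)"
  shows "Ck_on (Suc k) S f"
proof -
  have "Ck_on k S (\<lambda>x. frechet_derivative f (at x) v)" for v
    by (rule Ck_on_cong[OF assms(1) _ assms(3)]) (simp add: frechet_derivative_eqI[OF assms(2)])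
  then show ?thesis
    using assms(2) by (auto simp: differentiable_def)
qed

lemma Ck_on_SucD: "Ck_on (Suc k) S f \<Longrightarrow> Ck_on k S f"
proof (induction k arbitrary: f)
  case 0
  then show ?case
    by (auto intro!: continuous_at_imp_continuous_on differentiable_imp_continuous_within)
next
  case (Suc k)
  from Suc.prems have "Ck_on k S (\<lambda>x. frechet_derivative f (at x) v)" for v
    by (intro Suc.IH) simp
  then show ?case using Suc.prems by simp
qed

lemma Ck_on_has_derivative:
  "Ck_on (Suc k) S f \<Longrightarrow> x \<in> S \<Longrightarrow> (f has_derivative frechet_derivative f (at x)) (at x)"
  by (simp add: frechet_derivative_works)

lemma Ck_on_add:
  assumes "open S" "Ck_on k S f" "Ck_on k S g"
  shows "Ck_on k S (\<lambda>x. f x + g x)"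
  using assms(2,3)
proof (induction k arbitrary: f g)
  case 0
  then show ?case by (simp add: continuous_on_add)
next
  case (Suc k)
  show ?case
  proof (rule Ck_on_SucI[OF assms(1)])
    show "((\<lambda>x. f x + g x) has_derivative
        (\<lambda>v. frechet_derivative f (at x) v + frechet_derivative g (at x) v)) (at x)"
      if "x \<in> S" for x
      using Ck_on_has_derivative[OF Suc.prems(1) that] Ck_on_has_derivative[OF Suc.prems(2) that]
      by (rule has_derivative_add)
  qed (use Suc in auto)
qed

text \<open>One Leibniz induction covers scalar multiples, products and inner products. In each term
  of the product rule one factor is undifferentiated and is lowered from order \<open>Suc k\<close>
  to \<open>k\<close>.\<close>

lemma Ck_on_bilinear:
  assumes "bounded_bilinear mul" "open S" "Ck_on k S f" "Ck_on k S g"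
  shows "Ck_on k S (\<lambda>x. mul (f x) (g x))"
  using assms(3,4)
proof (induction k arbitrary: f g)
  case 0
  then show ?case by (simp add: bounded_bilinear.continuous_on[OF assms(1)])
next
  case (Suc k)
  show ?case
  proof (rule Ck_on_SucI[OF assms(2)])
    show "((\<lambda>x. mul (f x) (g x)) has_derivative
        (\<lambda>v. mul (f x) (frechet_derivative g (at x) v) + mul (frechet_derivative f (at x) v) (g x)))
        (at x)" if "x \<in> S" for x
      using Ck_on_has_derivative[OF Suc.prems(1) that] Ck_on_has_derivative[OF Suc.prems(2) that]
      by (rule bounded_bilinear.FDERIV[OF assms(1)])
    show "Ck_on k S (\<lambda>x. mul (f x) (frechet_derivative g (at x) v)
        + mul (frechet_derivative f (at x) v) (g x))" for v
      using Suc.prems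
      by (intro Ck_on_add[OF assms(2)] Suc.IH Ck_on_SucD[OF Suc.prems(1)] Ck_on_SucD[OF Suc.prems(2)])
        auto
  qed
qed

lemma Ck_on_exp:
  assumes "open S" "Ck_on k S f"
  shows "Ck_on k S (\<lambda>x. exp (f x :: real))"
  using assms(2)
proof (induction k)
  case 0
  then show ?case by (simp add: continuous_on_exp)
next
  case (Suc k)
  show ?case
  proof (rule Ck_on_SucI[OF assms(1)])
    show "((\<lambda>x. exp (f x)) has_derivative (\<lambda>v. exp (f x) * frechet_derivative f (at x) v)) (at x)"
      if "x \<in> S" for x
      using Ck_on_has_derivative[OF Suc.prems that]
      by (auto intro!: derivative_eq_intros)
    show "Ck_on k S (\<lambda>x. exp (f x) * frechet_derivative f (at x) v)" for v
      using Suc.prems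
      by (intro Ck_on_bilinear[OF bounded_bilinear_mult assms(1)] Suc.IH Ck_on_SucD[OF Suc.prems]) auto
  qed
qed

lemma Ck_on_const: "Ck_on k S (\<lambda>x. c)"
  by (induction k arbitrary: c) (auto simp: frechet_derivative_const)

text \<open>The constant \<open>a\<close> is kept free because the main proof multiplies by the
  factor with \<open>a\<close> equal to 1/(2m) and also by its reciprocal.\<close>

lemma smooth_map_exp_norm_scaleR:
  fixes x N :: "'a \<Rightarrow> 'b::euclidean_space" and A :: "('a, 'm::finite) chart set"
  assumes charts: "\<And>c. c \<in> A \<Longrightarrow> open (snd c ` fst c)"
    and x: "smooth_map A x" and N: "smooth_map A N"
  shows "smooth_map A (\<lambda>q. exp (a * (norm (x q))\<^sup>2) *\<^sub>R N q)"
  unfolding smooth_map_def smooth_on_def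
proof clarify
  fix U :: "'a set" and \<phi> k assume c: "(U, \<phi>) \<in> A"
  have S: "open (\<phi> ` U)" using charts[OF c] by simp
  have "Ck_on k (\<phi> ` U) (x \<circ> inv_into U \<phi>)" "Ck_on k (\<phi> ` U) (N \<circ> inv_into U \<phi>)"
    using x N c by (auto simp: smooth_map_def smooth_on_def)
  then show "Ck_on k (\<phi> ` U) ((\<lambda>q. exp (a * (norm (x q))\<^sup>2) *\<^sub>R N q) \<circ> inv_into U \<phi>)"
    unfolding comp_def power2_norm_eq_inner
    by (intro Ck_on_bilinear[OF bounded_bilinear_scaleR S] Ck_on_exp[OF S]
        Ck_on_bilinear[OF bounded_bilinear_mult S] Ck_on_const
        Ck_on_bilinear[OF bounded_bilinear_inner S])
qed

section \<open>Derivatives in charts\<close>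

lemma smooth_manifold_chart:
  assumes "smooth_manifold M A" "c \<in> A"
  shows "open (snd c ` fst c)" "inj_on (snd c) (fst c)" "fst c \<subseteq> topspace M"
proof -
  obtain U \<phi> where c: "c = (U, \<phi>)" by force
  have ch: "is_chart M (U, \<phi>)" using assms c by (auto simp: smooth_manifold_def)
  then have U: "U \<subseteq> topspace M" by (auto simp: is_chart_def openin_subset)
  then have top: "topspace (subtopology M U) = U" by auto
  have "homeomorphic_map (subtopology M U) (top_of_set (\<phi> ` U)) \<phi>" and op: "open (\<phi> ` U)"
    using ch by (simp_all add: is_chart_def)
  from homeomorphic_imp_injective_map[OF this(1)] have "inj_on \<phi> U"
    by (simp only: top)
  with U op show "open (snd c ` fst c)" "inj_on (snd c) (fst c)" "fst c \<subseteq> topspace M"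
    by (simp_all add: c)
qed

lemma deriv_in_cong:
  assumes "open (snd c ` fst c)" "q \<in> fst c" "\<And>r. r \<in> fst c \<Longrightarrow> f r = g r"
  shows "deriv_in c f q = deriv_in c g q"
proof -
  obtain U \<phi> where c: "c = (U, \<phi>)" by force
  \<comment> \<open>\<open>frechet_derivative\<close> is a choice from this relation, so equal
    relations give equal values even where no derivative exists.\<close>
  have "((f \<circ> inv_into U \<phi>) has_derivative D) (at (\<phi> q)) \<longleftrightarrow>
      ((g \<circ> inv_into U \<phi>) has_derivative D) (at (\<phi> q))" for D
    using assms unfolding c
    by (intro iffI; elim has_derivative_transform_within_open[where s = "\<phi> ` U"])
      (auto simp: inv_into_into)
  then show ?thesis
    by (simp add: deriv_in_def c fun_eq_iff frechet_derivative_def)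
qed

lemma smooth_map_has_derivative:
  assumes "smooth_map A f" "(U, \<phi>) \<in> A" "q \<in> U"
  shows "((f \<circ> inv_into U \<phi>) has_derivative deriv_in (U, \<phi>) f q) (at (\<phi> q))"
proof -
  have "Ck_on (Suc 0) (\<phi> ` U) (f \<circ> inv_into U \<phi>)"
    using assms by (auto simp: smooth_map_def smooth_on_def simp del: Ck_on.simps)
  then have "((f \<circ> inv_into U \<phi>) has_derivative frechet_derivative (f \<circ> inv_into U \<phi>) (at (\<phi> q)))
      (at (\<phi> q))"
    by (rule Ck_on_has_derivative) (use assms in auto)
  moreover have "deriv_in (U, \<phi>) f q = frechet_derivative (f \<circ> inv_into U \<phi>) (at (\<phi> q))"
    by (auto simp: deriv_in_def)
  ultimately show ?thesis by simp
qed

lemma linear_deriv_in: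
  assumes "smooth_map A f" "c \<in> A" "q \<in> fst c"
  shows "linear (deriv_in c f q)"
  using has_derivative_linear[OF smooth_map_has_derivative[OF assms(1), of "fst c" "snd c" q]] assms
  by simp

lemma deriv_in_exp_norm_scaleR:
  assumes "inj_on (snd c) (fst c)" "smooth_map A x" "smooth_map A N" "c \<in> A" "q \<in> fst c"
  shows "deriv_in c (\<lambda>q. exp (a * (norm (x q))\<^sup>2) *\<^sub>R N q) q v =
     exp (a * (norm (x q))\<^sup>2) *\<^sub>R (deriv_in c N q v + (2 * a * (x q \<bullet> deriv_in c x q v)) *\<^sub>R N q)"
proof -
  obtain U \<phi> where c: "c = (U, \<phi>)" by force
  have q: "inv_into U \<phi> (\<phi> q) = q" using assms c by simp
  note dx = smooth_map_has_derivative[OF assms(2,4)[unfolded c] assms(5)[unfolded c fst_conv]]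
  note dN = smooth_map_has_derivative[OF assms(3,4)[unfolded c] assms(5)[unfolded c fst_conv]]
  have "((\<lambda>u. exp (a * ((x \<circ> inv_into U \<phi>) u \<bullet> (x \<circ> inv_into U \<phi>) u)) *\<^sub>R (N \<circ> inv_into U \<phi>) u)
      has_derivative (\<lambda>v. exp (a * (norm (x q))\<^sup>2) *\<^sub>R
        (deriv_in c N q v + (2 * a * (x q \<bullet> deriv_in c x q v)) *\<^sub>R N q))) (at (\<phi> q))"
    by (rule derivative_eq_intros dx dN refl)+
      (simp add: fun_eq_iff c q power2_norm_eq_inner inner_commute algebra_simps)
  from frechet_derivative_eqI[OF this] show ?thesis
    by (simp add: deriv_in_def c comp_def power2_norm_eq_inner)
qed

section \<open>The Levi-Civita connection of the Gaussian metric\<close>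

text \<open>Uniqueness of the Levi-Civita connection at one point, which serves to evaluate the
  definite description in \<open>christoffel\<close>. Only at \<open>y\<close> itself must the
  metric be a multiple of the inner product.\<close>

lemma christoffel_unique:
  fixes G :: "'b::euclidean_space ambient_metric"
  assumes G: "\<And>v w. G y v w = e * (v \<bullet> w)" "e \<noteq> 0"
    and "bilinear \<Gamma>"
    and sym: "\<And>v w. \<Gamma> v w = \<Gamma> w v"
    and compat: "\<And>v w z. frechet_derivative (\<lambda>y'. G y' w z) (at y) v = G y (\<Gamma> v w) z + G y w (\<Gamma> v z)"
  shows "christoffel G y = \<Gamma>"
  unfolding christoffel_def
proof (rule the_equality)
  show "bilinear \<Gamma> \<and> (\<forall>v w. \<Gamma> v w = \<Gamma> w v) \<and>
      (\<forall>v w z. frechet_derivative (\<lambda>y'. G y' w z) (at y) v = G y (\<Gamma> v w) z + G y w (\<Gamma> v z))"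
    using assms by blast
next
  fix \<Delta>
  assume "bilinear \<Delta> \<and> (\<forall>v w. \<Delta> v w = \<Delta> w v) \<and>
      (\<forall>v w z. frechet_derivative (\<lambda>y'. G y' w z) (at y) v = G y (\<Delta> v w) z + G y w (\<Delta> v z))"
  then have sym': "\<And>v w. \<Delta> v w = \<Delta> w v"
    and compat': "\<And>v w z. G y (\<Gamma> v w) z + G y w (\<Gamma> v z) = G y (\<Delta> v w) z + G y w (\<Delta> v z)"
    using compat by metis+
  \<comment> \<open>The derivative of \<open>G\<close> cancels in the difference of two candidates,
    which leaves a form symmetric in its arguments and skew after pairing with a third
    vector.\<close>
  define E where "E v w = \<Delta> v w - \<Gamma> v w" for v w
  have E_sym: "E v w = E w v" for v w
    using sym sym' by (simp add: E_def)
  have skew: "E v w \<bullet> z = - (E v z \<bullet> w)" for v w z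
  proof -
    have "e * (\<Gamma> v w \<bullet> z + w \<bullet> \<Gamma> v z) = e * (\<Delta> v w \<bullet> z + w \<bullet> \<Delta> v z)"
      using compat'[of v w z] by (simp add: G distrib_left)
    with G(2) show ?thesis
      by (simp add: E_def inner_diff_left inner_diff_right inner_commute)
  qed
  \<comment> \<open>A trilinear form symmetric in one pair of slots and skew in another vanishes.\<close>
  have "E v w \<bullet> z = 0" for v w z
    using skew[of v w z] skew[of z v w] skew[of w z v] E_sym[of v z] E_sym[of z w] E_sym[of w v]
    by simp
  then have "E v w = 0" for v w
    by (metis inner_eq_zero_iff)
  then show "\<Delta> = \<Gamma>"
    by (simp add: E_def fun_eq_iff)
qed

text \<open>This is the conformal formula df(v) w + df(w) v - (v . w) grad f with f = -|y|^2/(2m),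
  whose gradient is -y/m.\<close>

lemma christoffel_gaussian:
  fixes y :: "'b::euclidean_space"
  shows "christoffel (gaussian_metric m) y v w =
    (1 / real m) *\<^sub>R ((v \<bullet> w) *\<^sub>R y - (y \<bullet> v) *\<^sub>R w - (y \<bullet> w) *\<^sub>R v)"
proof -
  let ?\<Gamma> = "\<lambda>v w. (1 / real m) *\<^sub>R ((v \<bullet> w) *\<^sub>R y - (y \<bullet> v) *\<^sub>R w - (y \<bullet> w) *\<^sub>R v)"
  have "christoffel (gaussian_metric m) y = ?\<Gamma>"
  proof (rule christoffel_unique)
    show "gaussian_metric m y v w = exp (- (norm y)\<^sup>2 / real m) * (v \<bullet> w)" for v w
      by (simp add: gaussian_metric_def)
    show "bilinear ?\<Gamma>"
      by (simp add: bilinear_def linear_iff algebra_simps inner_add_left inner_add_right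
          add_divide_distrib)
    show "?\<Gamma> v w = ?\<Gamma> w v" for v w
      by (simp add: inner_commute algebra_simps)
    show "frechet_derivative (\<lambda>y'. gaussian_metric m y' w z) (at y) v =
        gaussian_metric m y (?\<Gamma> v w) z + gaussian_metric m y w (?\<Gamma> v z)" for v w z
    proof -
      \<comment> \<open>The compatibility sum has to match this derivative: its mixed terms cancel
        in pairs and the two copies of -(y . v)(w . z)/m remain.\<close>
      have "((\<lambda>y'. exp ((- 1 / real m) * (y' \<bullet> y')) * (w \<bullet> z)) has_derivative
          (\<lambda>v. exp ((- 1 / real m) * (y \<bullet> y)) * ((- 2 / real m) * (y \<bullet> v)) * (w \<bullet> z))) (at y)"
        by (rule derivative_eq_intros refl)+ (simp add: fun_eq_iff inner_commute algebra_simps)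
      from frechet_derivative_eqI[OF this] show ?thesis
        by (simp add: gaussian_metric_def power2_norm_eq_inner inner_commute inner_diff_left
            inner_diff_right algebra_simps)
    qed
  qed simp
  then show ?thesis by simp
qed

section \<open>Normal parts\<close>

lemma gaussian_metric_eq_0_iff: "gaussian_metric m y v w = 0 \<longleftrightarrow> euclidean_metric y v w = 0"
  by (simp add: gaussian_metric_def euclidean_metric_def)

text \<open>Conformal metrics have the same orthogonality relation, so both projections are
  described by the same condition.\<close>

lemma normal_part_gaussian: "normal_part (gaussian_metric m) y T z = normal_part euclidean_metric y T z"
  by (simp add: normal_part_def gaussian_metric_eq_0_iff)

text \<open>Two candidates differ by a vector of \<open>T\<close> that is orthogonal to
  \<open>T\<close>, hence by zero.\<close>

lemma normal_part_eqI:
  assumes "subspace T" "\<And>t. t \<in> T \<Longrightarrow> n \<bullet> t = 0" "z - n \<in> T"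
  shows "normal_part euclidean_metric y T z = n"
  unfolding normal_part_def euclidean_metric_def
proof (rule the_equality)
  fix k assume k: "(\<forall>t\<in>T. k \<bullet> t = 0) \<and> z - k \<in> T"
  then have "n - k \<in> T"
    using subspace_diff[OF assms(1) _ assms(3), of "z - k"] by simp
  with k assms(2) have "(n - k) \<bullet> (n - k) = 0"
    by (simp add: inner_diff_left)
  then show "k = n" by simp
qed (use assms in auto)

lemma normal_part_works:
  assumes "subspace T"
  shows "t \<in> T \<Longrightarrow> normal_part euclidean_metric y T z \<bullet> t = 0"
    and "z - normal_part euclidean_metric y T z \<in> T"
proof -
  obtain u n where "u \<in> span T" "\<And>t. t \<in> span T \<Longrightarrow> orthogonal n t" "z = u + n"
    using orthogonal_subspace_decomp_exists by blast
  then have n: "\<And>t. t \<in> T \<Longrightarrow> n \<bullet> t = 0" "z - n \<in> T"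
    using span_eq_iff[THEN iffD2, OF assms] by (auto simp: orthogonal_def)
  then have "normal_part euclidean_metric y T z = n"
    by (rule normal_part_eqI[OF assms])
  with n show "t \<in> T \<Longrightarrow> normal_part euclidean_metric y T z \<bullet> t = 0"
    and "z - normal_part euclidean_metric y T z \<in> T" by auto
qed

lemma linear_normal_part:
  assumes "subspace T"
  shows "linear (normal_part euclidean_metric y T)"
proof (rule linearI)
  let ?P = "normal_part euclidean_metric y T"
  note P = normal_part_works[OF assms, where y = y]
  show "?P (a + b) = ?P a + ?P b" for a b
    using subspace_add[OF assms P(2)[of a] P(2)[of b]]
    by (intro normal_part_eqI[OF assms]) (auto simp: P(1) inner_add_left algebra_simps)
  show "?P (r *\<^sub>R a) = r *\<^sub>R ?P a" for r a
    using subspace_scale[OF assms P(2)[of a], of r]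
    by (intro normal_part_eqI[OF assms]) (auto simp: P(1) algebra_simps)
qed

lemma normal_part_tangent: "subspace T \<Longrightarrow> t \<in> T \<Longrightarrow> normal_part euclidean_metric y T t = 0"
  by (rule normal_part_eqI) auto

section \<open>Conformal change of the extrinsic geometry\<close>

lemma subspace_tangent_image:
  "linear (deriv_in c x q) \<Longrightarrow> subspace (tangent_image c x q)"
  by (simp add: tangent_image_def linear_subspace_image subspace_UNIV)

text \<open>Of the three Christoffel terms two are multiples of tangent vectors and are projected
  away; only the multiple of the position vector survives.\<close>

lemma second_ff_gaussian:
  assumes "linear (deriv_in c x q)"
  shows "second_ff (gaussian_metric m) c x q v w = second_ff euclidean_metric c x q v w +
    ((deriv_in c x q v \<bullet> deriv_in c x q w) / real m) *\<^sub>R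
      normal_part euclidean_metric (x q) (tangent_image c x q) (x q)"
proof -
  let ?T = "tangent_image c x q"
  let ?P = "normal_part euclidean_metric (x q) ?T"
  let ?d = "deriv_in c x q"
  note T = subspace_tangent_image[OF assms]
  note P = linear_normal_part[OF T, of "x q"]
  have [simp]: "?P (?d u) = 0" for u
    by (rule normal_part_tangent[OF T]) (simp add: tangent_image_def)
  show ?thesis
    unfolding second_ff_def pullback_conn_def normal_part_gaussian christoffel_gaussian
      christoffel_euclidean
    by (simp add: linear_add[OF P] linear_diff[OF P] linear_scale[OF P] scaleR_diff_right)
qed

text \<open>The exponent is chosen so that differentiating the factor yields (x . dx v)/m times
  \<open>N\<close>, which cancels the opposite Christoffel term.\<close>

lemma normal_conn_gaussian_exp_scaleR:
  fixes A :: "('a, 'm::finite) chart set"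
  assumes c: "inj_on (snd c) (fst c)" "c \<in> A" "q \<in> fst c"
    and x: "smooth_map A x" and N: "smooth_map A N"
    and normal: "\<And>t. t \<in> tangent_image c x q \<Longrightarrow> N q \<bullet> t = 0"
  shows "normal_conn (gaussian_metric m) c x (\<lambda>q. exp ((norm (x q))\<^sup>2 / (2 * real m)) *\<^sub>R N q) q v =
    exp ((norm (x q))\<^sup>2 / (2 * real m)) *\<^sub>R normal_conn euclidean_metric c x N q v"
proof -
  let ?T = "tangent_image c x q"
  let ?P = "normal_part euclidean_metric (x q) ?T"
  let ?d = "deriv_in c x q v"
  let ?e = "exp ((norm (x q))\<^sup>2 / (2 * real m))"
  note T = subspace_tangent_image[OF linear_deriv_in[OF x c(2,3)]]
  note P = linear_normal_part[OF T, of "x q"]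
  have d: "?d \<in> ?T" by (simp add: tangent_image_def)
  have Pd: "?P ?d = 0" by (rule normal_part_tangent[OF T d])
  have orth: "?d \<bullet> N q = 0" using normal[OF d] by (simp add: inner_commute)
  have "deriv_in c (\<lambda>q. exp ((norm (x q))\<^sup>2 / (2 * real m)) *\<^sub>R N q) q v =
      ?e *\<^sub>R (deriv_in c N q v + ((x q \<bullet> ?d) / real m) *\<^sub>R N q)"
    using deriv_in_exp_norm_scaleR[OF c(1) x N c(2,3), of "1 / (2 * real m)" v] by simp
  \<comment> \<open>The Christoffel term along \<open>x q\<close> vanishes since \<open>N q\<close>
    is normal; the remaining correction is tangent and disappears under projection.\<close>
  then have "pullback_conn (gaussian_metric m) c x
      (\<lambda>q. exp ((norm (x q))\<^sup>2 / (2 * real m)) *\<^sub>R N q) q v =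
      ?e *\<^sub>R (deriv_in c N q v - ((x q \<bullet> N q) / real m) *\<^sub>R ?d)"
    by (simp add: pullback_conn_def christoffel_gaussian orth algebra_simps)
  then show ?thesis
    unfolding normal_conn_def normal_part_gaussian
    by (simp add: pullback_conn_def christoffel_euclidean linear_diff[OF P] linear_scale[OF P] Pd)
qed

section \<open>Inverses and traces of Gram matrices\<close>

lemma matrix_inv_works:
  fixes B :: "real ^ 'm ^ 'm::finite"
  assumes "invertible B"
  shows "B ** matrix_inv B = mat 1" "matrix_inv B ** B = mat 1"
  using someI_ex[OF assms[unfolded invertible_def]] unfolding matrix_inv_def by auto

lemma matrix_inv_eqI:
  fixes B C :: "real ^ 'm ^ 'm::finite"
  assumes "B ** C = mat 1"
  shows "matrix_inv B = C"
proof -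
  have "invertible B"
    using assms by (auto simp: invertible_right_inverse)
  then have "matrix_inv B ** (B ** C) = C"
    by (simp add: matrix_mul_assoc matrix_inv_works)
  then show ?thesis
    by (simp add: assms)
qed

lemma matrix_inv_scaleR:
  fixes B :: "real ^ 'm ^ 'm::finite"
  assumes "invertible B" "k \<noteq> 0"
  shows "matrix_inv (k *\<^sub>R B) = inverse k *\<^sub>R matrix_inv B"
proof (rule matrix_inv_eqI)
  have "(k *\<^sub>R B) ** (inverse k *\<^sub>R matrix_inv B) = B ** matrix_inv B"
    using assms(2) by (simp add: vec_eq_iff matrix_matrix_mult_def field_simps)
  then show "(k *\<^sub>R B) ** (inverse k *\<^sub>R matrix_inv B) = mat 1"
    by (simp add: matrix_inv_works[OF assms(1)])
qed

text \<open>For the Gram matrix B, u . B u = |L u|^2, so its kernel is contained in that of the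
  injective map \<open>L\<close>. With \<open>L\<close> the differential of the immersion, this
  makes the induced metric invertible.\<close>

lemma invertible_gram_matrix:
  fixes L :: "real ^ 'm::finite \<Rightarrow> 'b::euclidean_space"
  assumes "linear L" "inj L"
  shows "invertible (\<chi> i j. L (axis i 1) \<bullet> L (axis j 1))" (is "invertible ?B")
proof -
  have "u = 0" if "?B *v u = 0" for u
  proof -
    have "L u = L (\<Sum>i\<in>UNIV. (u $ i) *\<^sub>R axis i 1)"
      by (simp add: basis_expansion scalar_mult_eq_scaleR[symmetric])
    then have L: "L u = (\<Sum>i\<in>UNIV. (u $ i) *\<^sub>R L (axis i 1))"
      by (simp add: linear_sum[OF assms(1)] linear_scale[OF assms(1)])
    have "0 = u \<bullet> (?B *v u)" by (simp add: that)
    also have "\<dots> = L u \<bullet> L u"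
      unfolding L
      by (simp add: inner_vec_def matrix_vector_mult_def inner_sum_left inner_sum_right
          sum_distrib_left mult_ac inner_commute)
    finally show ?thesis
      using assms by (metis inner_eq_zero_iff linear_injective_0)
  qed
  then show ?thesis
    by (simp add: invertible_left_inverse matrix_left_invertible_ker)
qed

text \<open>By symmetry the inner sums are the diagonal entries of the identity. The value m cancels
  the 1/m in the conformal second fundamental form.\<close>

lemma trace_matrix_inv_symmetric:
  fixes B :: "real ^ 'm ^ 'm::finite"
  assumes "invertible B" "\<And>i j. B $ i $ j = B $ j $ i"
  shows "(\<Sum>i\<in>UNIV. \<Sum>j\<in>UNIV. matrix_inv B $ i $ j * B $ i $ j) = real CARD('m)"
proof -
  have "(\<Sum>j\<in>UNIV. matrix_inv B $ i $ j * B $ i $ j) = (matrix_inv B ** B) $ i $ i" for i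
    unfolding matrix_matrix_mult_def using assms(2)[of i] by simp
  then show ?thesis
    using assms(1) by (simp add: matrix_inv_works mat_def)
qed

section \<open>The mean curvature vector under the conformal change\<close>

lemma mean_curvature_gaussian:
  fixes A :: "('a, 'm::finite) chart set" and x :: "'a \<Rightarrow> 'b::euclidean_space"
  defines "c \<equiv> \<lambda>q. chart_at A q"
  assumes lin: "linear (deriv_in (c q) x q)" and inj: "inj (deriv_in (c q) x q)"
  shows "mean_curvature (gaussian_metric CARD('m)) A x q =
    exp ((norm (x q))\<^sup>2 / real CARD('m)) *\<^sub>R (mean_curvature euclidean_metric A x q + position_normal A x q)"
proof -
  let ?m = "real CARD('m)"
  let ?d = "deriv_in (c q) x q"
  define B where "B = induced_metric euclidean_metric (c q) x q"
  define n where "n = position_normal A x q"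
  define h where "h i j = second_ff euclidean_metric (c q) x q (axis i 1) (axis j 1)" for i j
  have B: "B $ i $ j = ?d (axis i 1) \<bullet> ?d (axis j 1)" for i j
    by (simp add: B_def induced_metric_def euclidean_metric_def)
  have inv: "invertible B"
    using invertible_gram_matrix[OF lin inj]
    by (simp add: B_def induced_metric_def euclidean_metric_def)
  have "induced_metric (gaussian_metric CARD('m)) (c q) x q = exp (- (norm (x q))\<^sup>2 / ?m) *\<^sub>R B"
    by (simp add: vec_eq_iff B) (simp add: induced_metric_def gaussian_metric_def)
  then have minv: "matrix_inv (induced_metric (gaussian_metric CARD('m)) (c q) x q) =
      exp ((norm (x q))\<^sup>2 / ?m) *\<^sub>R matrix_inv B"
    by (simp add: matrix_inv_scaleR[OF inv] exp_minus[symmetric])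
  have h: "second_ff (gaussian_metric CARD('m)) (c q) x q (axis i 1) (axis j 1) =
      h i j + (B $ i $ j / ?m) *\<^sub>R n" for i j
    unfolding second_ff_gaussian[OF lin] h_def n_def position_normal_def B by (simp add: c_def)
  \<comment> \<open>Tracing the conformal correction gives the normal part of the position with
    coefficient exactly one; this is where the 1/m in the Gaussian exponent matters.\<close>
  have "(\<Sum>i\<in>UNIV. \<Sum>j\<in>UNIV. matrix_inv B $ i $ j *\<^sub>R ((B $ i $ j / ?m) *\<^sub>R n)) =
      ((\<Sum>i\<in>UNIV. \<Sum>j\<in>UNIV. matrix_inv B $ i $ j * B $ i $ j) / ?m) *\<^sub>R n"
    by (simp add: scaleR_sum_left sum_divide_distrib)
  also have "\<dots> = n"
    using trace_matrix_inv_symmetric[OF inv] by (simp add: B inner_commute)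
  finally have tr: "(\<Sum>i\<in>UNIV. \<Sum>j\<in>UNIV. matrix_inv B $ i $ j *\<^sub>R ((B $ i $ j / ?m) *\<^sub>R n)) = n" .
  have "mean_curvature (gaussian_metric CARD('m)) A x q =
      (\<Sum>i\<in>UNIV. \<Sum>j\<in>UNIV. (exp ((norm (x q))\<^sup>2 / ?m) *\<^sub>R matrix_inv B) $ i $ j *\<^sub>R
        (h i j + (B $ i $ j / ?m) *\<^sub>R n))"
    unfolding mean_curvature_def Let_def c_def[symmetric] minv h ..
  also have "\<dots> = exp ((norm (x q))\<^sup>2 / ?m) *\<^sub>R ((\<Sum>i\<in>UNIV. \<Sum>j\<in>UNIV. matrix_inv B $ i $ j *\<^sub>R h i j) +
      (\<Sum>i\<in>UNIV. \<Sum>j\<in>UNIV. matrix_inv B $ i $ j *\<^sub>R ((B $ i $ j / ?m) *\<^sub>R n)))"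
    by (simp add: scaleR_sum_right scaleR_add_right sum.distrib mult.assoc)
  also have "(\<Sum>i\<in>UNIV. \<Sum>j\<in>UNIV. matrix_inv B $ i $ j *\<^sub>R h i j) = mean_curvature euclidean_metric A x q"
    unfolding mean_curvature_def Let_def c_def[symmetric] B_def h_def ..
  finally show ?thesis
    by (simp only: tr) (simp only: n_def)
qed

section \<open>Transfer of parallel normal fields\<close>

lemma parallel_normal_field_cong:
  fixes A :: "('a, 'm::finite) chart set"
  assumes charts: "\<And>c. c \<in> A \<Longrightarrow> open (snd c ` fst c)"
    and eq: "\<And>c q. c \<in> A \<Longrightarrow> q \<in> fst c \<Longrightarrow> N q = N' q"
    and N: "parallel_normal_field G A x N"
  shows "parallel_normal_field G A x N'"
proof -
  have "smooth_map A N'"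
    unfolding smooth_map_def smooth_on_def
  proof clarify
    fix U :: "'a set" and \<phi> k assume c: "(U, \<phi>) \<in> A"
    have "Ck_on k (\<phi> ` U) (N \<circ> inv_into U \<phi>)"
      using N c by (auto simp: parallel_normal_field_def normal_field_def smooth_map_def smooth_on_def)
    then show "Ck_on k (\<phi> ` U) (N' \<circ> inv_into U \<phi>)"
      by (rule Ck_on_cong[rotated 2]) (use charts[OF c] eq[OF c] in \<open>auto simp: inv_into_into\<close>)
  qed
  moreover have "normal_conn G c x N' q v = normal_conn G c x N q v" if "c \<in> A" "q \<in> fst c" for c q v
    using deriv_in_cong[OF charts[OF that(1)] that(2) eq[OF that(1)]] eq[OF that]
    by (simp add: normal_conn_def pullback_conn_def)
  ultimately show ?thesis
    using N eq unfolding parallel_normal_field_def normal_field_def by auto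
qed

lemma parallel_normal_field_gaussian_exp_scaleR:
  fixes A :: "('a, 'm::finite) chart set" and x :: "'a \<Rightarrow> 'b::euclidean_space"
  assumes M: "smooth_manifold M A" and x: "smooth_map A x" and N: "smooth_map A N"
  shows "parallel_normal_field (gaussian_metric m) A x
      (\<lambda>q. exp ((norm (x q))\<^sup>2 / (2 * real m)) *\<^sub>R N q) \<longleftrightarrow>
    parallel_normal_field euclidean_metric A x N" (is "parallel_normal_field _ A x ?N \<longleftrightarrow> _")
proof -
  note charts = smooth_manifold_chart[OF M]
  have "smooth_map A ?N"
    using smooth_map_exp_norm_scaleR[OF charts(1) x N, where a = "1 / (2 * real m)"] by simp
  then have normal: "normal_field (gaussian_metric m) A x ?N \<longleftrightarrow> normal_field euclidean_metric A x N"
    using N by (simp add: normal_field_def gaussian_metric_eq_0_iff) (simp add: euclidean_metric_def)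
  have "normal_conn (gaussian_metric m) c x ?N q v = 0 \<longleftrightarrow> normal_conn euclidean_metric c x N q v = 0"
    \<comment> \<open>The two normal connections are proportional only on normal fields, so
      normality is compared first and then assumed here.\<close>
    if "normal_field euclidean_metric A x N" "c \<in> A" "q \<in> fst c" for c q v
    using that
    by (subst normal_conn_gaussian_exp_scaleR[OF charts(2) that(2,3) x N])
      (auto simp: normal_field_def euclidean_metric_def)
  with normal show ?thesis
    unfolding parallel_normal_field_def by blast
qed

theorem theorem3p1:
  fixes M :: "'a topology"
    and A :: "('a, 'm::finite) chart set"
    and x :: "'a \<Rightarrow> real ^ 'n::finite"
    and p :: nat
  assumes "smooth_manifold M A"
    and "CARD('n) = CARD('m) + p"
    and "smooth_immersion A x"
  shows "xi_submanifold M A x \<longleftrightarrow>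
         parallel_normal_field (gaussian_metric CARD('m)) A x (modified_mean_curvature A x)"
proof -
  let ?m = "real CARD('m)"
  let ?G = "gaussian_metric CARD('m) :: (real ^ 'n) ambient_metric"
  let ?H = "\<lambda>q. mean_curvature euclidean_metric A x q + position_normal A x q"
  let ?K = "modified_mean_curvature A x"
  note charts = smooth_manifold_chart[OF assms(1)]
  have x: "smooth_map A x" and inj: "\<And>c q. c \<in> A \<Longrightarrow> q \<in> fst c \<Longrightarrow> inj (deriv_in c x q)"
    using assms(3) by (auto simp: smooth_immersion_def)
  have M: "topspace M = (\<Union>c\<in>A. fst c)"
    using assms(1) by (simp add: smooth_manifold_def)
  have K: "?K q = exp ((norm (x q))\<^sup>2 / (2 * ?m)) *\<^sub>R ?H q" if "q \<in> topspace M" for q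
  proof -
    \<comment> \<open>The chosen chart is a genuine one because the chart domains cover
      \<open>topspace M\<close>; outside that set \<open>chart_at\<close> is arbitrary.\<close>
    have c: "chart_at A q \<in> A \<and> q \<in> fst (chart_at A q)"
      unfolding chart_at_def by (rule someI_ex[where P = "\<lambda>c. c \<in> A \<and> q \<in> fst c"])
        (use that M in auto)
    have "?K q = (exp (- (norm (x q))\<^sup>2 / (2 * ?m)) * exp ((norm (x q))\<^sup>2 / ?m)) *\<^sub>R ?H q"
      using c by (simp add: modified_mean_curvature_def
          mean_curvature_gaussian[OF linear_deriv_in[OF x] inj])
    \<comment> \<open>The exponents combine as -1/(2m) + 1/m = 1/(2m), the factor that intertwines
      the normal connections.\<close>
    also have "exp (- (norm (x q))\<^sup>2 / (2 * ?m)) * exp ((norm (x q))\<^sup>2 / ?m) =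
        exp ((norm (x q))\<^sup>2 / (2 * ?m))"
      by (simp add: exp_add[symmetric] field_simps)
    finally show ?thesis .
  qed
  show ?thesis
  proof
    assume "xi_submanifold M A x"
    then obtain \<xi> where \<xi>: "parallel_normal_field euclidean_metric A x \<xi>"
      and H: "\<And>q. q \<in> topspace M \<Longrightarrow> ?H q = \<xi> q"
      by (auto simp: xi_submanifold_def)
    then have "smooth_map A \<xi>"
      by (simp add: parallel_normal_field_def normal_field_def)
    with \<xi> have par: "parallel_normal_field ?G A x (\<lambda>q. exp ((norm (x q))\<^sup>2 / (2 * ?m)) *\<^sub>R \<xi> q)"
      using parallel_normal_field_gaussian_exp_scaleR[OF assms(1) x] by blast
    \<comment> \<open>The fields are known to agree only on the manifold, not on the whole type, so
      a congruence for parallel fields replaces rewriting.\<close>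
    have eq: "exp ((norm (x q))\<^sup>2 / (2 * ?m)) *\<^sub>R \<xi> q = ?K q" if "c \<in> A" "q \<in> fst c" for c q
    proof -
      have "q \<in> topspace M" using that M by blast
      then show ?thesis by (simp only: K H)
    qed
    show "parallel_normal_field ?G A x ?K"
      by (rule parallel_normal_field_cong[OF charts(1) eq par])
  next
    assume *: "parallel_normal_field ?G A x ?K"
    \<comment> \<open>Defining the witness from \<open>?K\<close> instead of \<open>?H\<close> makes
      \<open>?K\<close> a global multiple of it and lets it inherit smoothness from
      \<open>?K\<close>; it equals \<open>?H\<close> on \<open>topspace M\<close>.\<close>
    define \<xi> where "\<xi> q = exp (- (norm (x q))\<^sup>2 / (2 * ?m)) *\<^sub>R ?K q" for q
    have "smooth_map A ?K"
      using * by (simp add: parallel_normal_field_def normal_field_def)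
    then have "smooth_map A \<xi>"
      using smooth_map_exp_norm_scaleR[OF charts(1) x, where N = ?K and a = "- 1 / (2 * ?m)"]
      by (simp add: \<xi>_def[abs_def])
    moreover have "?K = (\<lambda>q. exp ((norm (x q))\<^sup>2 / (2 * ?m)) *\<^sub>R \<xi> q)"
      by (simp add: \<xi>_def fun_eq_iff exp_add[symmetric])
    ultimately have "parallel_normal_field euclidean_metric A x \<xi>"
      using * parallel_normal_field_gaussian_exp_scaleR[OF assms(1) x, of \<xi> "CARD('m)"] by simp
    moreover have "?H q = \<xi> q" if "q \<in> topspace M" for q
      by (simp add: \<xi>_def K[OF that] exp_add[symmetric])
    ultimately show "xi_submanifold M A x"
      unfolding xi_submanifold_def by blast
  qed
qed

end
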